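(* In dimension $d=2$, for every $N\geq1$ and every positive integer $n$, we have \[ \mathfrak{S}_{\mathbb{T}^2}(N)\geq\mathfrak{R}(N), \quad \widetilde{\mathfrak{S}}_{\mathbb{T}^2}(n)\geq\widetilde{\mathfrak{R}}(n) \] and \[ \mathfrak{M}_{\mathbb{T}^2}(N)\geq\mathfrak{R}^{\mathrm{pin}}(N), \quad \widetilde{\mathfrak{M}}_{\mathbb{T}^2}(n)\geq\widetilde{\mathfrak{R}}^{\mathrm{pin}}(n). \]
   Context: Combinatorial quantities. For a finite set $A\subseteq\mathbb{Z}^2$ define (degenerate configurations included) \[ \Box(A) := \{(k_1,k_2,k_3,k_4)\in A^4 : k_1+k_3=k_2+k_4,\ (k_2-k_1)\cdot(k_4-k_1)=0 \}, \] \[ \triangle(A) := \{(k_1,k_2,k_3)\in A^3 : (2k_3-k_1-k_2)\cdot(k_2-k_1)=0\}, \] and, for $k\in A$, \[ \triangle^k(A) := \{(k_1,k_2,k)\in A^3 : (2k-k_1-k_2)\cdot(k_2-k_1)=0\}. \] $\#E$ denotes cardinality. For $N\ge1$, \[ \mathfrak{R}(N) := \max_{\emptyset\ne A\subseteq\mathbb{Z}^2\cap[-N,N]^2} \frac{\#\Box(A)}{\#\triangle(A)},\quad \mathfrak{R}^{\mathrm{pin}}(N) := \max_{\emptyset\ne A\subseteq\mathbb{Z}^2\cap[-N,N]^2} \frac{\#\Box(A)}{\#A\, \max_{k\in A} \#\triangle^k(A)}, \] and for a positive integer $n$, \[ \widetilde{\mathfrak{R}}(n) := \sup_{A\subseteq\mathbb{Z}^2,\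 \#A=n} \frac{\#\Box(A)}{\#\triangle(A)},\quad \widetilde{\mathfrak{R}}^{\mathrm{pin}}(n) := \sup_{A\subseteq\mathbb{Z}^2,\ \#A=n} \frac{\#\Box(A)}{\#A\, \max_{k\in A} \#\triangle^k(A)}. \] Analytic quantities. Let $\mathbb{T}^d=\mathbb{R}^d/\mathbb{Z}^d$. A weight is a nonnegative (locally) integrable function $w$ on $\mathbb{T}^d\times\mathbb{T}$; put $\rho^{\ast}_{\mathbb{Z}^d}w(x,k)=\int_0^1 w(x-2tk,t)\,\mathrm{d}t\in[0,\infty]$ for $(x,k)\in\mathbb{T}^d\times\mathbb{Z}^d$, with $0\cdot\infty=0$. For a trigonometric polynomial $u_0$ on $\mathbb{T}^d$ put \[ u(x,t)=\sum_{k\in\mathbb{Z}^d}\widehat{u_0}(k)e^{2\pi i(x\cdot k+t|k|^2)},\quad (x,t)\in\mathbb{T}^d\times\mathbb{T}. \] Consider the inequalities \[ \text{(Stein)}\quad \int_{\mathbb{T}} \int_{\mathbb{T}^d} |u|^2w\,\mathrm{d}x\,\mathrm{d}t\leq C\sum_{k\in\mathbb{Z}^d}|\widehat{u_0}(k)|^2\sup_{x\in\mathbb{T}^d}\rho^{\ast}_{\mathbb{Z}^{d}}w(x,k), \] \[ \text{(MT)}\quad \int_{\mathbb{T}} \int_{\mathbb{T}^d} |u|^2w\,\mathrm{d}x\,\mathrm{d}t\leq C \sup_{x\in\mathbb{T}^d,\ k\in\operatorname{supp}\widehat{u_0}}\rho^{\ast}_{\mathbb{Z}^{d}}w(x,k)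 \,\|u_0\|_{\mathrm{L}^2(\mathbb{T}^d)}^2. \] For $N\ge1$, $\mathfrak{S}_{\mathbb{T}^d}(N)$ and $\mathfrak{M}_{\mathbb{T}^d}(N)$ are the least constants $C\in[0,\infty]$ such that (Stein), respectively (MT), holds for all weights $w$ and all trigonometric polynomials $u_0$ with $\operatorname{supp}\widehat{u_0}\subseteq\mathbb{Z}^d\cap[-N,N]^d$. For a positive integer $n$, $\widetilde{\mathfrak{S}}_{\mathbb{T}^d}(n)$ and $\widetilde{\mathfrak{M}}_{\mathbb{T}^d}(n)$ are the least constants $C\in[0,\infty]$ such that (Stein), respectively (MT), holds for all weights $w$ and all trigonometric polynomials $u_0$ with $\#\operatorname{supp}\widehat{u_0}=n$. *)

theory Defs
  imports "HOL-Analysis.Analysis"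
begin

text \<open>The lattice \<open>\<int>\<^sup>d\<close> is taken as a subset of \<open>\<real>\<^sup>d\<close>, so that the Euclidean
  inner product and scalar multiplication apply to frequencies directly.\<close>

definition int_lattice :: "(real ^ 'd) set" where
  "int_lattice = {k. \<forall>i. k $ i \<in> \<int>}"

definition lattice_cube :: "real \<Rightarrow> (real ^ 'd) set" where
  "lattice_cube N = {k \<in> int_lattice. \<forall>i. - N \<le> k $ i \<and> k $ i \<le> N}"


definition rectangles :: "(real ^ 2) set \<Rightarrow> ((real ^ 2) \<times> (real ^ 2) \<times> (real ^ 2) \<times> (real ^ 2)) set" where
  "rectangles A = {(k1, k2, k3, k4). k1 \<in> A \<and> k2 \<in> A \<and> k3 \<in> A \<and> k4 \<in> A \<and>
     k1 + k3 = k2 + k4 \<and> (k2 - k1) \<bullet> (k4 - k1) = 0}"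

definition triangles :: "(real ^ 2) set \<Rightarrow> ((real ^ 2) \<times> (real ^ 2) \<times> (real ^ 2)) set" where
  "triangles A = {(k1, k2, k3). k1 \<in> A \<and> k2 \<in> A \<and> k3 \<in> A \<and>
     (2 *\<^sub>R k3 - k1 - k2) \<bullet> (k2 - k1) = 0}"

definition pinned_triangles ::
  "(real ^ 2) set \<Rightarrow> real ^ 2 \<Rightarrow> ((real ^ 2) \<times> (real ^ 2) \<times> (real ^ 2)) set" where
  "pinned_triangles A k = {(k1, k2, k3). k1 \<in> A \<and> k2 \<in> A \<and> k3 = k \<and>
     (2 *\<^sub>R k - k1 - k2) \<bullet> (k2 - k1) = 0}"

definition ratio :: "(real ^ 2) set \<Rightarrow> real" where
  "ratio A = real (card (rectangles A)) / real (card (triangles A))"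

definition pin_ratio :: "(real ^ 2) set \<Rightarrow> real" where
  "pin_ratio A = real (card (rectangles A)) /
     (real (card A) * real (Max ((\<lambda>k. card (pinned_triangles A k)) ` A)))"

definition R_box :: "real \<Rightarrow> real" where
  "R_box N = Max (ratio ` {A. A \<noteq> {} \<and> A \<subseteq> lattice_cube N})"

definition R_pin_box :: "real \<Rightarrow> real" where
  "R_pin_box N = Max (pin_ratio ` {A. A \<noteq> {} \<and> A \<subseteq> lattice_cube N})"

text \<open>The suprema below range over infinitely many sets and are taken in \<open>[0, \<infinity>]\<close>.
  For \<open>n > 0\<close> the condition \<open>card A = n\<close> entails finiteness.\<close>

definition R_card :: "nat \<Rightarrow> ennreal" where
  "R_card n = (SUP A \<in> {A. A \<subseteq> int_lattice \<and> card A = n}. ennreal (ratio A))"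

definition R_pin_card :: "nat \<Rightarrow> ennreal" where
  "R_pin_card n = (SUP A \<in> {A. A \<subseteq> int_lattice \<and> card A = n}. ennreal (pin_ratio A))"


text \<open>Functions on the torus \<open>\<real>\<^sup>d / \<int>\<^sup>d\<close> are \<open>\<int>\<^sup>d\<close>-periodic functions on \<open>\<real>\<^sup>d\<close>,
  integrated over the unit cube; a supremum over the torus is one over \<open>\<real>\<^sup>d\<close>.\<close>

abbreviation unit_cube :: "(real ^ 'd) set" where
  "unit_cube \<equiv> cbox 0 1"

text \<open>Borel measurability (rather than Lebesgue measurability) ensures that the restriction
  of a weight to every single line is measurable, so that \<open>\<rho>\<^sup>* w\<close> is defined pointwise.\<close>

definition weight :: "(real ^ 'd \<Rightarrow> real \<Rightarrow> real) \<Rightarrow> bool" where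
  "weight w \<longleftrightarrow>
     (\<forall>x t. 0 \<le> w x t) \<and>
     (\<forall>x t. \<forall>m\<in>int_lattice. \<forall>j\<in>\<int>. w (x + m) (t + j) = w x t) \<and>
     (\<lambda>(x, t). w x t) \<in> borel_measurable borel \<and>
     set_integrable lborel (unit_cube \<times> {0..1}) (\<lambda>(x, t). w x t)"

definition rho_star :: "(real ^ 'd \<Rightarrow> real \<Rightarrow> real) \<Rightarrow> real ^ 'd \<Rightarrow> real ^ 'd \<Rightarrow> ennreal" where
  "rho_star w x k = (\<integral>\<^sup>+t\<in>{0..1}. ennreal (w (x - (2 * t) *\<^sub>R k) t) \<partial>lborel)"

definition trig_poly :: "(real ^ 'd \<Rightarrow> complex) \<Rightarrow> bool" where
  "trig_poly f \<longleftrightarrow> (\<exists>S c. finite S \<and> S \<subseteq> int_lattice \<and>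
     f = (\<lambda>x. \<Sum>k\<in>S. c k * cis (2 * pi * (x \<bullet> k))))"

definition fourier_coeff :: "(real ^ 'd \<Rightarrow> complex) \<Rightarrow> real ^ 'd \<Rightarrow> complex" where
  "fourier_coeff f k = (LINT x:unit_cube|lborel. f x * cis (- (2 * pi * (x \<bullet> k))))"

definition spectrum :: "(real ^ 'd \<Rightarrow> complex) \<Rightarrow> (real ^ 'd) set" where
  "spectrum f = {k \<in> int_lattice. fourier_coeff f k \<noteq> 0}"

definition torus_L2_norm :: "(real ^ 'd \<Rightarrow> complex) \<Rightarrow> real" where
  "torus_L2_norm f = sqrt (LINT x:unit_cube|lborel. (cmod (f x))\<^sup>2)"

text \<open>Sums over \<open>\<int>\<^sup>d\<close> weighted by the Fourier coefficients are written as sums over the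
  spectrum, which is finite for a trigonometric polynomial.\<close>

definition evolution :: "(real ^ 'd \<Rightarrow> complex) \<Rightarrow> real ^ 'd \<Rightarrow> real \<Rightarrow> complex" where
  "evolution u0 x t =
     (\<Sum>k\<in>spectrum u0. fourier_coeff u0 k * cis (2 * pi * (x \<bullet> k + t * (norm k)\<^sup>2)))"

definition weighted_energy ::
  "(real ^ 'd \<Rightarrow> complex) \<Rightarrow> (real ^ 'd \<Rightarrow> real \<Rightarrow> real) \<Rightarrow> ennreal" where
  "weighted_energy u0 w =
     (\<integral>\<^sup>+t\<in>{0..1}. (\<integral>\<^sup>+x\<in>unit_cube. ennreal ((cmod (evolution u0 x t))\<^sup>2 * w x t) \<partial>lborel) \<partial>lborel)"

text \<open>In \<^typ>\<open>ennreal\<close> the convention \<open>0 \<cdot> \<infinity> = 0\<close> holds and the supremum over the empty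
  set is \<open>0\<close>.\<close>

definition stein_ineq ::
  "ennreal \<Rightarrow> (real ^ 'd \<Rightarrow> complex) \<Rightarrow> (real ^ 'd \<Rightarrow> real \<Rightarrow> real) \<Rightarrow> bool" where
  "stein_ineq C u0 w \<longleftrightarrow> weighted_energy u0 w \<le>
     C * (\<Sum>k\<in>spectrum u0. ennreal ((cmod (fourier_coeff u0 k))\<^sup>2) * (SUP x. rho_star w x k))"

definition mt_ineq ::
  "ennreal \<Rightarrow> (real ^ 'd \<Rightarrow> complex) \<Rightarrow> (real ^ 'd \<Rightarrow> real \<Rightarrow> real) \<Rightarrow> bool" where
  "mt_ineq C u0 w \<longleftrightarrow> weighted_energy u0 w \<le>
     C * (SUP (x, k) \<in> UNIV \<times> spectrum u0. rho_star w x k) * ennreal ((torus_L2_norm u0)\<^sup>2)"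

text \<open>The first argument of the constants below carries the dimension \<open>d\<close>.\<close>

definition S_box :: "'d::finite itself \<Rightarrow> real \<Rightarrow> ennreal" where
  "S_box _ N = Inf {C. \<forall>(w :: real ^ 'd \<Rightarrow> real \<Rightarrow> real) u0.
     weight w \<and> trig_poly u0 \<and> spectrum u0 \<subseteq> lattice_cube N \<longrightarrow> stein_ineq C u0 w}"

definition M_box :: "'d::finite itself \<Rightarrow> real \<Rightarrow> ennreal" where
  "M_box _ N = Inf {C. \<forall>(w :: real ^ 'd \<Rightarrow> real \<Rightarrow> real) u0.
     weight w \<and> trig_poly u0 \<and> spectrum u0 \<subseteq> lattice_cube N \<longrightarrow> mt_ineq C u0 w}"

definition S_card :: "'d::finite itself \<Rightarrow> nat \<Rightarrow> ennreal" where
  "S_card _ n = Inf {C. \<forall>(w :: real ^ 'd \<Rightarrow> real \<Rightarrow> real) u0.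
     weight w \<and> trig_poly u0 \<and> card (spectrum u0) = n \<longrightarrow> stein_ineq C u0 w}"

definition M_card :: "'d::finite itself \<Rightarrow> nat \<Rightarrow> ennreal" where
  "M_card _ n = Inf {C. \<forall>(w :: real ^ 'd \<Rightarrow> real \<Rightarrow> real) u0.
     weight w \<and> trig_poly u0 \<and> card (spectrum u0) = n \<longrightarrow> mt_ineq C u0 w}"

end

theory Submission imports Defs begin

text \<open>All four inequalities come from testing the analytic inequalities on a single family.
  For a finite set \<open>A\<close> of frequencies let \<open>u(x, t) = \<Sum>\<^sub>k\<^sub>\<in>\<^sub>A e(x \<bullet> k + t |k|\<^sup>2)\<close>, where
  \<open>e(s) = exp(2 \<pi> i s)\<close>, take \<open>u(\<cdot>, 0)\<close> as initial datum, and choose the weight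
  \<open>w = |u|\<^sup>2\<close>. Every Fourier coefficient on \<open>A\<close> is then \<open>1\<close>, and both sides become counting
  problems by orthogonality of characters.

  The left-hand side is \<open>\<integral>\<integral> |u|\<^sup>4\<close>. Expanding into characters, the terms that survive are the
  quadruples with \<open>k1 + k3 = k2 + k4\<close> and \<open>|k1|\<^sup>2 + |k3|\<^sup>2 = |k2|\<^sup>2 + |k4|\<^sup>2\<close>; these two
  equations describe exactly the rectangles (\<open>weighted_energy_exp_sum\<close>).

  On the line \<open>x - 2tk\<close> the density \<open>|u|\<^sup>2\<close> is a sum over pairs \<open>(k1, k2)\<close> of characters in
  \<open>t\<close> of frequency \<open>|k1|\<^sup>2 - |k2|\<^sup>2 - 2k \<bullet> (k1 - k2) = (2k - k1 - k2) \<bullet> (k2 - k1)\<close>, with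
  coefficients of modulus one depending on \<open>x\<close>. Integrating in \<open>t\<close> keeps the pairs that form
  a triangle pinned at \<open>k\<close>, so \<open>\<rho>\<^sup>* w(x, k)\<close> is at most the number of such triangles for every
  \<open>x\<close> (\<open>rho_star_exp_sum_density_le\<close>).

  For the Stein inequality, summing over \<open>k \<in> A\<close> counts all triangles; for the Mizohata--Takeuchi
  inequality, the supremum over \<open>k \<in> A\<close> gives the largest pinned count, and
  \<open>\<parallel>u(\<cdot>, 0)\<parallel>\<^sup>2\<close> is the cardinality of \<open>A\<close>. Any admissible constant therefore dominates the
  corresponding ratio of \<open>A\<close>.\<close>


section \<open>Orthogonality of characters on the torus\<close>

text \<open>Stated over an arbitrary Euclidean space so that it covers the space frequencies in
  \<open>\<int>\<^sup>d\<close> and the time frequencies in \<open>\<int>\<close> alike.\<close>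

definition int_vector :: "'a::euclidean_space \<Rightarrow> bool" where
  "int_vector m \<longleftrightarrow> (\<forall>b\<in>Basis. m \<bullet> b \<in> \<int>)"

lemma set_integral_cis_unit_interval:
  assumes "a \<in> \<int>"
  shows "(LINT s:{0..1}|lborel. cis (2 * pi * (s * a))) = (if a = 0 then 1 else 0)"
proof (cases "a = 0")
  case True
  then show ?thesis by (simp add: set_lebesgue_integral_def)
next
  case False
  define c where "c = \<i> * complex_of_real (2 * pi * a)"
  have c: "c \<noteq> 0" and cis_c: "cis (2 * pi * (s * a)) = exp (c * complex_of_real s)" for s
    using False by (simp_all add: c_def cis_conv_exp mult_ac)
  define F where "F s = exp (c * complex_of_real s) / c" for s
  have "exp (c * complex_of_real 1) = 1"
    using cis_multiple_2pi[OF assms] cis_c[of 1] by simp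
  then have "F 1 = F 0"
    by (simp add: F_def)
  have "((\<lambda>z. exp (c * z) / c) has_field_derivative exp (c * complex_of_real s)) (at (complex_of_real s))" for s
    using c by (auto intro!: derivative_eq_intros)
  then have "(F has_vector_derivative exp (c * complex_of_real s)) (at s within {0..1})" for s
    unfolding F_def by (rule has_vector_derivative_real_field)
  moreover have "continuous_on {0..1} (\<lambda>s. exp (c * complex_of_real s))"
    by (intro continuous_intros)
  ultimately have "(\<integral>s. indicator {0..1} s *\<^sub>R exp (c * complex_of_real s) \<partial>lborel) = F 1 - F 0"
    by (intro integral_FTC_atLeastAtMost) auto
  with False \<open>F 1 = F 0\<close> show ?thesis
    by (simp add: set_lebesgue_integral_def cis_c)
qed

lemma continuous_on_cis_linear:
  "continuous_on S (\<lambda>x::'a::euclidean_space. cis (2 * pi * (x \<bullet> m)))"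
  unfolding cis_conv_exp by (intro continuous_intros)

lemma prod_indicator_cube:
  "(\<Prod>b\<in>Basis. indicator {0..1} (y b))
    = (indicator (cbox 0 One) (\<Sum>b\<in>Basis. y b *\<^sub>R b :: 'a::euclidean_space) :: real)"
proof (cases "\<forall>b\<in>(Basis :: 'a set). y b \<in> {0..1}")
  case True
  then show ?thesis by (simp add: mem_box)
next
  case False
  then obtain b :: 'a where b: "b \<in> Basis" "y b \<notin> {0..1}" by blast
  then have "(\<Prod>b\<in>(Basis :: 'a set). indicator {0..1} (y b)) = (0 :: real)"
    by (intro prod_zero bexI[of _ b]) auto
  moreover have "(\<Sum>b\<in>Basis. y b *\<^sub>R b) \<notin> cbox 0 (One :: 'a)"
    using b by (auto simp: mem_box)
  ultimately show ?thesis by simp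
qed

text \<open>Both the indicator of the cube and the character factor over the coordinates, so Fubini
  reduces the integral to a product of one-dimensional ones.\<close>

lemma set_integral_cis_unit_cube:
  fixes m :: "'a::euclidean_space"
  assumes "int_vector m"
  shows "(LINT x:cbox 0 One|lborel. cis (2 * pi * (x \<bullet> m))) = (if m = 0 then 1 else 0)"
proof -
  define f :: "'a \<Rightarrow> real \<Rightarrow> complex" where
    "f b s = indicator {0..1} s *\<^sub>R cis (2 * pi * (s * (m \<bullet> b)))" for b s
  interpret product_sigma_finite "\<lambda>b::'a. lborel :: real measure"
    by standard
  have f_int: "integrable lborel (f b)" for b
    unfolding f_def
    by (intro borel_integrable_compact compact_Icc) (auto simp: cis_conv_exp intro!: continuous_intros)
  have split: "indicator (cbox 0 One) (\<Sum>b\<in>Basis. y b *\<^sub>R b) *\<^sub>R cis (2 * pi * ((\<Sum>b\<in>Basis. y b *\<^sub>R b) \<bullet> m))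
      = (\<Prod>b\<in>Basis. f b (y b))" for y :: "'a \<Rightarrow> real"
  proof -
    have "(\<Prod>b\<in>Basis. f b (y b)) = complex_of_real (\<Prod>b\<in>Basis. indicator {0..1} (y b))
        * (\<Prod>b\<in>Basis. cis (2 * pi * (y b * (m \<bullet> b))))"
      by (simp add: f_def scaleR_conv_of_real prod.distrib)
    also have "(\<Prod>b\<in>Basis. cis (2 * pi * (y b * (m \<bullet> b))))
        = cis (\<Sum>b\<in>Basis. 2 * pi * (y b * (m \<bullet> b)))"
      by (simp add: cis_conv_exp exp_sum sum_distrib_left)
    also have "(\<Sum>b\<in>Basis. 2 * pi * (y b * (m \<bullet> b))) = 2 * pi * ((\<Sum>b\<in>Basis. y b *\<^sub>R b) \<bullet> m)"
      by (simp add: sum_distrib_left inner_sum_left inner_commute[of m])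
    also have "(\<Prod>b\<in>Basis. indicator {0..1} (y b)) = (indicator (cbox 0 One) (\<Sum>b\<in>Basis. y b *\<^sub>R b) :: real)"
      by (simp add: prod_indicator_cube)
    finally show ?thesis by (simp add: scaleR_conv_of_real)
  qed
  have "(LINT x:cbox 0 One|lborel. cis (2 * pi * (x \<bullet> m)))
      = (\<integral>y. (\<Prod>b\<in>Basis. f b (y b)) \<partial>(\<Pi>\<^sub>M b\<in>Basis. lborel))"
  proof -
    have "(\<lambda>x. cis (2 * pi * (x \<bullet> m))) \<in> borel_measurable borel"
      by (intro borel_measurable_continuous_onI continuous_on_cis_linear)
    then have [measurable]: "(\<lambda>x. indicator (cbox 0 One) x *\<^sub>R cis (2 * pi * (x \<bullet> m))) \<in> borel_measurable borel"
      by measurable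
    show ?thesis
      unfolding set_lebesgue_integral_def
      by (subst lborel_eq, subst integral_distr) (simp_all add: split)
  qed
  also have "\<dots> = (\<Prod>b\<in>Basis. integral\<^sup>L lborel (f b))"
    by (intro product_integral_prod f_int) simp
  also have "\<dots> = (\<Prod>b\<in>Basis. if m \<bullet> b = 0 then 1 else 0)"
    using set_integral_cis_unit_interval assms
    by (intro prod.cong) (simp_all add: f_def[abs_def] int_vector_def set_lebesgue_integral_def)
  also have "\<dots> = (if m = 0 then 1 else 0)"
    using euclidean_all_zero_iff[of m] by (auto simp: prod_zero_iff)
  finally show ?thesis .
qed

text \<open>The frequencies \<open>m i\<close> may repeat: the constant term of the sum collects all coefficients
  with \<open>m i = 0\<close>. This is how integrals turn into counts below.\<close>

lemma set_integral_trig_sum: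
  fixes m :: "'i \<Rightarrow> 'a::euclidean_space"
  assumes "finite I" and "\<And>i. i \<in> I \<Longrightarrow> int_vector (m i)"
  shows "(LINT x:cbox 0 One|lborel. \<Sum>i\<in>I. c i * cis (2 * pi * (x \<bullet> m i))) = (\<Sum>i\<in>{i\<in>I. m i = 0}. c i)"
proof -
  have int: "integrable lborel (\<lambda>x. indicator (cbox 0 One) x *\<^sub>R (c i * cis (2 * pi * (x \<bullet> m i))))" for i
    by (intro borel_integrable_compact continuous_intros continuous_on_cis_linear) simp
  have "(LINT x:cbox 0 One|lborel. \<Sum>i\<in>I. c i * cis (2 * pi * (x \<bullet> m i)))
      = (\<Sum>i\<in>I. LINT x:cbox 0 One|lborel. c i * cis (2 * pi * (x \<bullet> m i)))"
    unfolding set_lebesgue_integral_def scaleR_sum_right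
    by (rule Bochner_Integration.integral_sum) (rule int)
  also have "\<dots> = (\<Sum>i\<in>I. c i * (if m i = 0 then 1 else 0))"
    using assms(2) by (intro sum.cong refl) (simp add: set_integral_cis_unit_cube)
  also have "\<dots> = (\<Sum>i\<in>{i\<in>I. m i = 0}. c i)"
    using assms(1) by (simp add: sum.inter_filter if_distrib cong: if_cong)
  finally show ?thesis .
qed

text \<open>Squared moduli are real, but the individual characters in their expansions are not; hence
  the form with a real function whose complexification is a given trigonometric sum.\<close>

lemma real_trig_sum_integral:
  fixes m :: "'i \<Rightarrow> 'a::euclidean_space" and g :: "'a \<Rightarrow> real"
  assumes "finite I" and "\<And>i. i \<in> I \<Longrightarrow> int_vector (m i)"
    and g: "\<And>x. complex_of_real (g x) = (\<Sum>i\<in>I. c i * cis (2 * pi * (x \<bullet> m i)))"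
  shows "complex_of_real (LINT x:cbox 0 One|lborel. g x) = (\<Sum>i\<in>{i\<in>I. m i = 0}. c i)"
  using set_integral_trig_sum[of I m c] assms
  by (simp flip: set_integral_complex_of_real)

lemma nn_integral_compact_eq_set_integral:
  fixes g :: "'a::euclidean_space \<Rightarrow> real"
  assumes "compact K" and "continuous_on K g" and "\<And>x. x \<in> K \<Longrightarrow> 0 \<le> g x"
  shows "(\<integral>\<^sup>+x\<in>K. ennreal (g x) \<partial>lborel) = ennreal (LINT x:K|lborel. g x)"
proof -
  have "(\<integral>\<^sup>+x\<in>K. ennreal (g x) \<partial>lborel) = (\<integral>\<^sup>+x. ennreal (indicator K x *\<^sub>R g x) \<partial>lborel)"
    by (intro nn_integral_cong) (simp split: split_indicator)
  also have "\<dots> = ennreal (LINT x:K|lborel. g x)"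
    unfolding set_lebesgue_integral_def
    using assms by (intro nn_integral_eq_integral borel_integrable_compact) (auto split: split_indicator)
  finally show ?thesis .
qed

text \<open>The expansion also supplies the continuity of \<open>g\<close>, which is how an iterated integral such
  as \<open>t \<mapsto> \<integral> |u(x, t)|\<^sup>4 dx\<close> can itself be integrated without a separate argument.\<close>

lemma nn_integral_trig_sum:
  fixes m :: "'i \<Rightarrow> 'a::euclidean_space" and g :: "'a \<Rightarrow> real"
  assumes g: "\<And>x. complex_of_real (g x) = (\<Sum>i\<in>I. c i * cis (2 * pi * (x \<bullet> m i)))"
    and "\<And>x. 0 \<le> g x"
  shows "(\<integral>\<^sup>+x\<in>cbox 0 One. ennreal (g x) \<partial>lborel) = ennreal (LINT x:cbox 0 One|lborel. g x)"
proof (rule nn_integral_compact_eq_set_integral)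
  have "g = (\<lambda>x. Re (\<Sum>i\<in>I. c i * cis (2 * pi * (x \<bullet> m i))))"
    unfolding fun_eq_iff using g by (metis Re_complex_of_real)
  then show "continuous_on (cbox 0 One) g"
    by (simp only:) (intro continuous_intros continuous_on_cis_linear)
qed (use assms in auto)


section \<open>Integer vectors and the unit cube\<close>

lemma int_lattice_iff_int_vector: "k \<in> int_lattice \<longleftrightarrow> int_vector k"
  by (auto simp: int_lattice_def int_vector_def Basis_vec_def inner_axis)

lemma unit_cube_eq_cbox_One: "(unit_cube :: (real ^ 'd) set) = cbox 0 One"
proof -
  have "(1 :: real ^ 'd) = One"
  proof (rule euclidean_eqI)
    fix b :: "real ^ 'd"
    assume b: "b \<in> Basis"
    then obtain i where "b = axis i 1"
      by (auto simp: Basis_vec_def)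
    then have "1 \<bullet> b = 1"
      by (simp add: inner_axis)
    with b show "1 \<bullet> b = One \<bullet> b"
      by (simp add: inner_sum_left inner_Basis)
  qed
  then show ?thesis by simp
qed

lemma int_vector_diff: "int_vector a \<Longrightarrow> int_vector b \<Longrightarrow> int_vector (a - b)"
  by (simp add: int_vector_def inner_diff_left)

lemma int_vector_add: "int_vector a \<Longrightarrow> int_vector b \<Longrightarrow> int_vector (a + b)"
  by (simp add: int_vector_def inner_add_left)

lemma int_vector_inner: "int_vector a \<Longrightarrow> int_vector b \<Longrightarrow> a \<bullet> b \<in> \<int>"
  by (subst euclidean_inner) (auto simp: int_vector_def intro!: Ints_sum Ints_mult)

lemma int_vector_real [simp]: "int_vector (a::real) \<longleftrightarrow> a \<in> \<int>"
  by (simp add: int_vector_def)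


lemma cbox_One_real: "cbox 0 (One :: real) = {0..1}"
  by (simp add: cbox_interval)


section \<open>The Schroedinger exponential sum of a frequency set\<close>

definition exp_sum :: "(real ^ 'd) set \<Rightarrow> real ^ 'd \<Rightarrow> real \<Rightarrow> complex" where
  "exp_sum A x t = (\<Sum>k\<in>A. cis (2 * pi * (x \<bullet> k + t * (norm k)\<^sup>2)))"

abbreviation exp_sum_density :: "(real ^ 'd) set \<Rightarrow> real ^ 'd \<Rightarrow> real \<Rightarrow> real" where
  "exp_sum_density A x t \<equiv> (cmod (exp_sum A x t))\<^sup>2"

lemma cmod_square_sum_cis:
  "complex_of_real ((cmod (\<Sum>i\<in>I. cis (\<theta> i)))\<^sup>2) = (\<Sum>(i, j)\<in>I \<times> I. cis (\<theta> i - \<theta> j))"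
proof -
  have "complex_of_real ((cmod (\<Sum>i\<in>I. cis (\<theta> i)))\<^sup>2) = (\<Sum>i\<in>I. cis (\<theta> i)) * (\<Sum>j\<in>I. cis (- \<theta> j))"
    by (simp only: complex_norm_square cnj_sum cis_cnj)
  also have "\<dots> = (\<Sum>(i, j)\<in>I \<times> I. cis (\<theta> i) * cis (- \<theta> j))"
    by (simp only: sum_product sum.cartesian_product)
  finally show ?thesis
    by (simp only: cis_mult diff_conv_add_uminus)
qed

lemma exp_sum_density_expand:
  "complex_of_real (exp_sum_density A x t)
    = (\<Sum>(k, l)\<in>A \<times> A. cis (2 * pi * (x \<bullet> (k - l) + t * ((norm k)\<^sup>2 - (norm l)\<^sup>2))))"
  unfolding exp_sum_def cmod_square_sum_cis
  by (intro sum.cong refl) (auto simp: inner_diff_right algebra_simps)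

lemma int_vector_norm_square: "int_vector k \<Longrightarrow> (norm k)\<^sup>2 \<in> \<int>"
  by (simp add: power2_norm_eq_inner int_vector_inner)

lemma exp_sum_periodic:
  assumes "A \<subseteq> int_lattice" and "m \<in> int_lattice" and "j \<in> \<int>"
  shows "exp_sum A (x + m) (t + j) = exp_sum A x t"
  unfolding exp_sum_def
proof (rule sum.cong[OF refl])
  fix k assume "k \<in> A"
  with assms have "int_vector k" "int_vector m"
    by (auto simp flip: int_lattice_iff_int_vector)
  with \<open>j \<in> \<int>\<close> have "m \<bullet> k + j * (norm k)\<^sup>2 \<in> \<int>"
    by (intro Ints_add Ints_mult int_vector_inner int_vector_norm_square)
  then have "cis (2 * pi * (m \<bullet> k + j * (norm k)\<^sup>2)) = 1"
    by (rule cis_multiple_2pi)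
  moreover have "2 * pi * ((x + m) \<bullet> k + (t + j) * (norm k)\<^sup>2)
      = 2 * pi * (x \<bullet> k + t * (norm k)\<^sup>2) + 2 * pi * (m \<bullet> k + j * (norm k)\<^sup>2)"
    by (simp add: inner_add_left algebra_simps)
  ultimately show "cis (2 * pi * ((x + m) \<bullet> k + (t + j) * (norm k)\<^sup>2))
      = cis (2 * pi * (x \<bullet> k + t * (norm k)\<^sup>2))"
    by (simp only: cis_mult[symmetric] mult_1_right)
qed

lemma weight_exp_sum_density:
  fixes A :: "(real ^ 'd) set"
  assumes "A \<subseteq> int_lattice"
  shows "weight (exp_sum_density A)"
proof -
  have cont: "continuous_on S (\<lambda>(x, t). exp_sum_density A x t)" for S
    unfolding exp_sum_def cis_conv_exp case_prod_beta by (intro continuous_intros)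
  have "set_integrable lborel (unit_cube \<times> {0..1}) (\<lambda>(x, t). exp_sum_density A x t)"
    unfolding set_integrable_def
    by (intro borel_integrable_compact compact_Times compact_cbox compact_Icc cont)
  moreover have "(\<lambda>(x, t). exp_sum_density A x t) \<in> borel_measurable borel"
    by (intro borel_measurable_continuous_onI cont)
  ultimately show ?thesis
    using exp_sum_periodic[OF assms] by (simp add: weight_def)
qed

context
  fixes A :: "(real ^ 'd) set"
  assumes A: "finite A" "A \<subseteq> int_lattice"
begin

lemma trig_poly_exp_sum: "trig_poly (\<lambda>x. exp_sum A x 0)"
  unfolding trig_poly_def exp_sum_def
  by (rule exI[of _ A], rule exI[of _ "\<lambda>_. 1"]) (simp add: A)

lemma int_vector_frequency: "k \<in> A \<Longrightarrow> int_vector k"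
  using A(2) by (auto simp flip: int_lattice_iff_int_vector)

lemma fourier_coeff_exp_sum:
  assumes "k \<in> int_lattice"
  shows "fourier_coeff (\<lambda>x. exp_sum A x 0) k = (if k \<in> A then 1 else 0)"
proof -
  have "exp_sum A x 0 * cis (- (2 * pi * (x \<bullet> k))) = (\<Sum>l\<in>A. 1 * cis (2 * pi * (x \<bullet> (l - k))))" for x
    unfolding exp_sum_def sum_distrib_right cis_mult
    by (intro sum.cong refl) (simp add: inner_diff_right algebra_simps)
  then have "fourier_coeff (\<lambda>x. exp_sum A x 0) k = (\<Sum>l\<in>{l\<in>A. l - k = 0}. 1)"
    unfolding fourier_coeff_def unit_cube_eq_cbox_One
    using assms A(1) int_vector_frequency
    by (simp only: set_integral_trig_sum int_vector_diff int_lattice_iff_int_vector)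
  also have "{l\<in>A. l - k = 0} = (if k \<in> A then {k} else {})"
    by auto
  finally show ?thesis by simp
qed

lemma spectrum_exp_sum: "spectrum (\<lambda>x. exp_sum A x 0) = A"
  using A(2) by (auto simp: spectrum_def fourier_coeff_exp_sum split: if_splits)

lemma evolution_exp_sum: "evolution (\<lambda>x. exp_sum A x 0) = exp_sum A"
proof (intro ext)
  fix x t
  have "fourier_coeff (\<lambda>x. exp_sum A x 0) k = 1" if "k \<in> A" for k
    using that A(2) by (subst fourier_coeff_exp_sum) auto
  then have "evolution (\<lambda>x. exp_sum A x 0) x t = (\<Sum>k\<in>A. cis (2 * pi * (x \<bullet> k + t * (norm k)\<^sup>2)))"
    unfolding evolution_def spectrum_exp_sum by simp
  then show "evolution (\<lambda>x. exp_sum A x 0) x t = exp_sum A x t"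
    by (simp add: exp_sum_def)
qed

lemma torus_L2_norm_exp_sum: "(torus_L2_norm (\<lambda>x. exp_sum A x 0))\<^sup>2 = card A"
proof -
  let ?I = "LINT x:cbox 0 One|lborel. exp_sum_density A x 0"
  have "complex_of_real ?I = (\<Sum>i\<in>{i\<in>A \<times> A. fst i - snd i = 0}. 1)"
  proof (rule real_trig_sum_integral)
    show "complex_of_real (exp_sum_density A x 0)
        = (\<Sum>i\<in>A \<times> A. 1 * cis (2 * pi * (x \<bullet> (fst i - snd i))))" for x
      unfolding exp_sum_density_expand by (simp add: case_prod_beta)
  qed (use A(1) int_vector_frequency in \<open>auto simp: int_vector_diff\<close>)
  also have "{i\<in>A \<times> A. fst i - snd i = 0} = (\<lambda>k. (k, k)) ` A"
    by auto
  also have "(\<Sum>i\<in>\<dots>. 1) = complex_of_real (card A)"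
    by (simp add: card_image inj_on_def)
  finally have "?I = card A"
    by (simp only: of_real_eq_iff)
  then show ?thesis
    by (simp add: torus_L2_norm_def unit_cube_eq_cbox_One)
qed

end


section \<open>Counting triangles and rectangles\<close>

text \<open>The integral in \<open>t\<close> is a sum of numbers of modulus one, one for each pinned triangle; the
  bound is the triangle inequality (with equality at \<open>x = 0\<close>).\<close>

lemma rho_star_exp_sum_density_le:
  assumes "finite A" and "A \<subseteq> int_lattice" and "k \<in> int_lattice"
  shows "rho_star (exp_sum_density A) x k \<le> ennreal (card (pinned_triangles A k))"
proof -
  define s where "s p = (2 *\<^sub>R k - fst p - snd p) \<bullet> (snd p - fst p)" for p :: "(real ^ 2) \<times> (real ^ 2)"
  define c where "c p = cis (2 * pi * (x \<bullet> (fst p - snd p)))" for p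
  define I where "I = {p \<in> A \<times> A. s p = 0}"
  let ?g = "\<lambda>t. exp_sum_density A (x - (2 * t) *\<^sub>R k) t"
  have g: "complex_of_real (?g t) = (\<Sum>p\<in>A \<times> A. c p * cis (2 * pi * (t \<bullet> s p)))" for t
    unfolding exp_sum_density_expand case_prod_beta c_def s_def cis_mult
    by (intro sum.cong refl arg_cong[of _ _ cis])
      (simp add: power2_norm_eq_inner inner_diff_left inner_diff_right inner_commute algebra_simps)
  have "int_vector (s p)" if "p \<in> A \<times> A" for p
  proof -
    have "int_vector k" "int_vector (fst p)" "int_vector (snd p)"
      using that assms by (auto simp flip: int_lattice_iff_int_vector)
    then show ?thesis
      \<comment> \<open>writing \<open>2k\<close> as \<open>k + k\<close> makes it visibly an integer vector\<close>
      unfolding s_def int_vector_real scaleR_2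
      by (intro int_vector_inner int_vector_diff int_vector_add)
  qed
  with g have int: "complex_of_real (LINT t:{0..1}|lborel. ?g t) = (\<Sum>p\<in>I. c p)"
    unfolding I_def cbox_One_real[symmetric]
    using assms(1) by (intro real_trig_sum_integral) auto
  have "(LINT t:{0..1}|lborel. ?g t) \<le> cmod (complex_of_real (LINT t:{0..1}|lborel. ?g t))"
    by simp
  also have "\<dots> \<le> (\<Sum>p\<in>I. cmod (c p))"
    unfolding int by (rule norm_sum)
  also have "\<dots> = card I"
    by (simp add: c_def)
  also have "card I = card ((\<lambda>(k1, k2). (k1, k2, k)) ` I)"
    by (intro card_image[symmetric]) (auto simp: inj_on_def)
  also have "(\<lambda>(k1, k2). (k1, k2, k)) ` I = pinned_triangles A k"
    by (auto simp: I_def s_def pinned_triangles_def image_iff)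
  finally have "(LINT t:{0..1}|lborel. ?g t) \<le> card (pinned_triangles A k)" .
  moreover have "rho_star (exp_sum_density A) x k = ennreal (LINT t:{0..1}|lborel. ?g t)"
    unfolding rho_star_def cbox_One_real[symmetric] by (rule nn_integral_trig_sum[OF g]) simp
  ultimately show ?thesis
    by (simp add: ennreal_leI)
qed

text \<open>The integral of the fourth power of the modulus. The space integral forces
  \<open>k1 + k3 = k2 + k4\<close>; after substituting \<open>k3 = k2 + k4 - k1\<close> the time frequency equals
  \<open>2 (k2 - k1) \<bullet> (k4 - k1)\<close>, so the time integral forces the right angle at \<open>k1\<close>.\<close>

lemma weighted_energy_exp_sum:
  assumes "finite A" and "A \<subseteq> int_lattice"
  shows "weighted_energy (\<lambda>x. exp_sum A x 0) (exp_sum_density A) = ennreal (card (rectangles A))"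
proof -
  let ?J = "(A \<times> A) \<times> (A \<times> A)"
  define m :: "((real ^ 2) \<times> (real ^ 2)) \<times> ((real ^ 2) \<times> (real ^ 2)) \<Rightarrow> real ^ 2"
    where "m = (\<lambda>((k1, k2), (k3, k4)). (k1 - k2) + (k3 - k4))"
  define s :: "((real ^ 2) \<times> (real ^ 2)) \<times> ((real ^ 2) \<times> (real ^ 2)) \<Rightarrow> real"
    where "s = (\<lambda>((k1, k2), (k3, k4)). ((norm k1)\<^sup>2 - (norm k2)\<^sup>2) + ((norm k3)\<^sup>2 - (norm k4)\<^sup>2))"
  define g where "g t x = exp_sum_density A x t * exp_sum_density A x t" for t x
  define h where "h t = (LINT x:cbox 0 One|lborel. g t x)" for t
  have int_m: "int_vector (m i)" if "i \<in> ?J" for i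
    using that by (auto simp: m_def int_vector_add int_vector_diff int_vector_frequency[OF assms])
  have int_s: "int_vector (s i)" if "i \<in> ?J" for i
    using that unfolding s_def by (auto intro!: Ints_add Ints_diff int_vector_norm_square int_vector_frequency[OF assms])
  have g: "complex_of_real (g t x) = (\<Sum>i\<in>?J. cis (2 * pi * (t \<bullet> s i)) * cis (2 * pi * (x \<bullet> m i)))" for t x
    unfolding g_def of_real_mult exp_sum_density_expand sum_product sum.cartesian_product cis_mult
    by (intro sum.cong refl)
      (auto simp: m_def s_def cis_mult inner_add_right algebra_simps intro!: arg_cong[of _ _ cis])
  have h: "complex_of_real (h t) = (\<Sum>i\<in>{i\<in>?J. m i = 0}. 1 * cis (2 * pi * (t \<bullet> s i)))" for t
    unfolding h_def mult_1_left using assms(1) int_m g by (intro real_trig_sum_integral) auto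
  have g_nonneg: "0 \<le> g t x" for t x
    by (simp add: g_def)
  have h_nonneg: "0 \<le> h t" for t
    unfolding h_def set_lebesgue_integral_def by (intro integral_nonneg_AE AE_I2) (simp add: g_nonneg)
  have "weighted_energy (\<lambda>x. exp_sum A x 0) (exp_sum_density A)
      = (\<integral>\<^sup>+t\<in>{0..1}. (\<integral>\<^sup>+x\<in>cbox 0 One. ennreal (g t x) \<partial>lborel) \<partial>lborel)"
    unfolding weighted_energy_def evolution_exp_sum[OF assms] unit_cube_eq_cbox_One g_def ..
  also have "\<dots> = (\<integral>\<^sup>+t\<in>cbox 0 One. ennreal (h t) \<partial>lborel)"
    unfolding h_def cbox_One_real using nn_integral_trig_sum[OF g g_nonneg] by simp
  also have "\<dots> = ennreal (LINT t:cbox 0 One|lborel. h t)"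
    by (rule nn_integral_trig_sum[OF h h_nonneg])
  also have "(LINT t:cbox 0 One|lborel. h t) = card (rectangles A)"
  proof -
    define R where "R = {i \<in> {i \<in> ?J. m i = 0}. s i = 0}"
    have "complex_of_real (LINT t:cbox 0 One|lborel. h t) = (\<Sum>i\<in>R. 1)"
      unfolding R_def using assms(1) int_s h by (intro real_trig_sum_integral) auto
    also have "\<dots> = complex_of_real (card R)"
      by simp
    also have "card R = card ((\<lambda>((k1, k2), (k3, k4)). (k1, k2, k3, k4)) ` R)"
      by (intro card_image[symmetric]) (auto simp: inj_on_def)
    also have "(\<lambda>((k1, k2), (k3, k4)). (k1, k2, k3, k4)) ` R = rectangles A"
    proof -
      have "m ((k1, k2), (k3, k4)) = 0 \<and> s ((k1, k2), (k3, k4)) = 0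
          \<longleftrightarrow> k1 + k3 = k2 + k4 \<and> (k2 - k1) \<bullet> (k4 - k1) = 0" for k1 k2 k3 k4
      proof -
        have m: "m ((k1, k2), (k3, k4)) = 0 \<longleftrightarrow> k3 = k2 + k4 - k1"
          by (auto simp: m_def algebra_simps)
        moreover have "s ((k1, k2), (k3, k4)) = 2 * ((k2 - k1) \<bullet> (k4 - k1))" if "k3 = k2 + k4 - k1"
          unfolding that s_def power2_norm_eq_inner
          by (simp add: inner_diff_left inner_diff_right inner_add_left inner_add_right inner_commute algebra_simps)
        moreover have "k1 + k3 = k2 + k4 \<longleftrightarrow> k3 = k2 + k4 - k1"
          by (auto simp: algebra_simps)
        ultimately show ?thesis by auto
      qed
      then show ?thesis
        unfolding R_def rectangles_def by (force simp: image_iff)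
    qed
    finally show ?thesis
      by (simp only: of_real_eq_iff)
  qed
  finally show ?thesis .
qed

lemma finite_pinned_triangles: "finite A \<Longrightarrow> finite (pinned_triangles A k)"
  by (rule finite_subset[of _ "A \<times> A \<times> {k}"]) (auto simp: pinned_triangles_def)

lemma card_triangles_eq_sum_pinned:
  assumes "finite A"
  shows "card (triangles A) = (\<Sum>k\<in>A. card (pinned_triangles A k))"
proof -
  have "triangles A = (\<Union>k\<in>A. pinned_triangles A k)"
    by (auto simp: triangles_def pinned_triangles_def)
  also have "card \<dots> = (\<Sum>k\<in>A. card (pinned_triangles A k))"
    using assms by (intro card_UN_disjoint) (auto simp: finite_pinned_triangles, auto simp: pinned_triangles_def)
  finally show ?thesis .
qed

text \<open>The degenerate triangle \<open>(k, k, k)\<close> keeps the denominators of both ratios positive.\<close>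

lemma card_pinned_triangles_pos:
  assumes "finite A" and "k \<in> A"
  shows "0 < card (pinned_triangles A k)"
proof -
  have "(k, k, k) \<in> pinned_triangles A k"
    using assms(2) by (simp add: pinned_triangles_def)
  then show ?thesis
    using finite_pinned_triangles[OF assms(1)] by (auto simp: card_gt_0_iff)
qed


section \<open>Admissible constants dominate the ratios\<close>

lemma ennreal_divide_le_of_le_mult:
  assumes "ennreal a \<le> C * ennreal b" and "0 \<le> a" and "0 < b"
  shows "ennreal (a / b) \<le> C"
  using assms by (simp flip: divide_ennreal add: divide_le_posI_ennreal mult.commute)

text \<open>With unit coefficients, the sum on the right-hand side is at most the number of triangles of
  \<open>A\<close>, counted according to their third vertex.\<close>

lemma ratio_le_of_stein_ineq:
  assumes A: "finite A" "A \<subseteq> int_lattice" "A \<noteq> {}"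
    and stein: "stein_ineq C (\<lambda>x. exp_sum A x 0) (exp_sum_density A)"
  shows "ennreal (ratio A) \<le> C"
proof -
  have "ennreal (card (rectangles A)) \<le> C * (\<Sum>k\<in>A. SUP x. rho_star (exp_sum_density A) x k)"
    using stein A(2) unfolding stein_ineq_def
    by (simp add: weighted_energy_exp_sum spectrum_exp_sum fourier_coeff_exp_sum A subset_iff cong: sum.cong)
  also have "\<dots> \<le> C * (\<Sum>k\<in>A. ennreal (card (pinned_triangles A k)))"
    using A by (intro mult_left_mono sum_mono SUP_least rho_star_exp_sum_density_le) auto
  also have "(\<Sum>k\<in>A. ennreal (card (pinned_triangles A k))) = ennreal (card (triangles A))"
    by (simp add: card_triangles_eq_sum_pinned A(1))
  finally have "ennreal (card (rectangles A)) \<le> C * ennreal (card (triangles A))" .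
  moreover have "0 < card (triangles A)"
    unfolding card_triangles_eq_sum_pinned[OF A(1)]
    using A by (intro sum_pos card_pinned_triangles_pos) auto
  ultimately show ?thesis
    unfolding ratio_def by (intro ennreal_divide_le_of_le_mult) auto
qed

lemma pin_ratio_le_of_mt_ineq:
  assumes A: "finite A" "A \<subseteq> int_lattice" "A \<noteq> {}"
    and mt: "mt_ineq C (\<lambda>x. exp_sum A x 0) (exp_sum_density A)"
  shows "ennreal (pin_ratio A) \<le> C"
proof -
  define M where "M = Max ((\<lambda>k. card (pinned_triangles A k)) ` A)"
  have le_M: "card (pinned_triangles A k) \<le> M" if "k \<in> A" for k
    unfolding M_def using A(1) that by (intro Max_ge) auto
  have "ennreal (card (rectangles A))
      \<le> C * (SUP (x, k) \<in> UNIV \<times> A. rho_star (exp_sum_density A) x k) * ennreal (card A)"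
    using mt unfolding mt_ineq_def
    by (simp add: weighted_energy_exp_sum spectrum_exp_sum torus_L2_norm_exp_sum A)
  also have "\<dots> \<le> C * ennreal M * ennreal (card A)"
  proof (intro mult_right_mono mult_left_mono SUP_least)
    fix p assume p: "p \<in> (UNIV :: (real ^ 2) set) \<times> A"
    then have "rho_star (exp_sum_density A) (fst p) (snd p) \<le> ennreal (card (pinned_triangles A (snd p)))"
      using A by (intro rho_star_exp_sum_density_le) auto
    also have "\<dots> \<le> ennreal M"
      using p le_M by (intro ennreal_leI) auto
    finally show "(case p of (x, k) \<Rightarrow> rho_star (exp_sum_density A) x k) \<le> ennreal M"
      by (simp add: case_prod_beta)
  qed auto
  also have "\<dots> = C * ennreal (card A * M)"
    by (simp add: ennreal_mult mult_ac)
  finally have "ennreal (card (rectangles A)) \<le> C * ennreal (card A * M)" .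
  moreover have "0 < card A * M"
  proof -
    obtain k where "k \<in> A" using A(3) by blast
    then show ?thesis
      using le_M card_pinned_triangles_pos[OF A(1)] A(1) by (fastforce simp: card_gt_0_iff)
  qed
  ultimately show ?thesis
    unfolding pin_ratio_def M_def[symmetric] of_nat_mult[symmetric] by (intro ennreal_divide_le_of_le_mult) auto
qed

lemma finite_lattice_cube: "finite (lattice_cube N :: (real ^ 'd) set)"
proof -
  let ?Z = "{z :: real. z \<in> \<int> \<and> \<bar>z\<bar> \<le> N}"
  have "finite ?Z"
    by (rule finite_abs_int_segment)
  then have "finite {f :: 'd \<Rightarrow> real. \<forall>i. f i \<in> ?Z}"
    using finite_set_of_finite_funs[of "UNIV :: 'd set" ?Z] by simp
  then have "finite (vec_lambda ` {f :: 'd \<Rightarrow> real. \<forall>i. f i \<in> ?Z})"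
    by (rule finite_imageI)
  moreover have "lattice_cube N \<subseteq> vec_lambda ` {f :: 'd \<Rightarrow> real. \<forall>i. f i \<in> ?Z}"
    by (rule subsetI, rule_tac x = "vec_nth x" in image_eqI)
      (auto simp: lattice_cube_def int_lattice_def abs_le_iff minus_le_iff)
  ultimately show ?thesis
    by (rule finite_subset[rotated])
qed

text \<open>Finiteness of the cube makes the maxima over its subsets genuine; the singleton at the
  origin shows that they are taken over a nonempty family.\<close>

lemma Max_subsets_lattice_cube:
  fixes f :: "(real ^ 'd) set \<Rightarrow> real"
  assumes "0 \<le> N"
  obtains A where "A \<noteq> {}" "A \<subseteq> lattice_cube N"
    "Max (f ` {A. A \<noteq> {} \<and> A \<subseteq> lattice_cube N}) = f A"
proof -
  have "0 \<in> (lattice_cube N :: (real ^ 'd) set)"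
    using assms by (simp add: lattice_cube_def int_lattice_def)
  then have "{0} \<in> {A :: (real ^ 'd) set. A \<noteq> {} \<and> A \<subseteq> lattice_cube N}"
    by simp
  moreover have "finite {A :: (real ^ 'd) set. A \<noteq> {} \<and> A \<subseteq> lattice_cube N}"
    using finite_lattice_cube by (rule finite_subset[OF _ finite_Pow_iff[THEN iffD2], rotated]) auto
  ultimately have "Max (f ` {A. A \<noteq> {} \<and> A \<subseteq> lattice_cube N}) \<in> f ` {A. A \<noteq> {} \<and> A \<subseteq> lattice_cube N}"
    by (intro Max_in) auto
  then show ?thesis using that by auto
qed

theorem theorem1p4:
  fixes N :: real and n :: nat
  assumes "N \<ge> 1" and "n > 0"
  shows "S_box TYPE(2) N \<ge> ennreal (R_box N)
    \<and> S_card TYPE(2) n \<ge> R_card n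
    \<and> M_box TYPE(2) N \<ge> ennreal (R_pin_box N)
    \<and> M_card TYPE(2) n \<ge> R_pin_card n"
proof (intro conjI)
  have cube: "finite A" "A \<subseteq> int_lattice" if "A \<subseteq> lattice_cube N" for A :: "(real ^ 2) set"
    using finite_subset[OF that finite_lattice_cube] that by (auto simp: lattice_cube_def)
  have card: "finite A" "A \<noteq> {}" if "card A = n" for A :: "(real ^ 2) set"
    using that \<open>n > 0\<close> by (auto intro: card_ge_0_finite)
  have "0 \<le> N" using \<open>N \<ge> 1\<close> by simp
  \<comment> \<open>the test data meet the side conditions of the four infima\<close>
  note admissible = weight_exp_sum_density trig_poly_exp_sum spectrum_exp_sum
  show "S_box TYPE(2) N \<ge> ennreal (R_box N)"
  proof -
    obtain A where A: "A \<noteq> {}" "A \<subseteq> lattice_cube N" "R_box N = ratio A"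
      unfolding R_box_def by (rule Max_subsets_lattice_cube[OF \<open>0 \<le> N\<close>])
    then show ?thesis
      unfolding S_box_def using cube[OF A(2)]
      by (auto intro!: Inf_greatest ratio_le_of_stein_ineq simp: admissible)
  qed
  show "M_box TYPE(2) N \<ge> ennreal (R_pin_box N)"
  proof -
    obtain A where A: "A \<noteq> {}" "A \<subseteq> lattice_cube N" "R_pin_box N = pin_ratio A"
      unfolding R_pin_box_def by (rule Max_subsets_lattice_cube[OF \<open>0 \<le> N\<close>])
    then show ?thesis
      unfolding M_box_def using cube[OF A(2)]
      by (auto intro!: Inf_greatest pin_ratio_le_of_mt_ineq simp: admissible)
  qed
  show "S_card TYPE(2) n \<ge> R_card n"
    unfolding R_card_def
  proof (rule SUP_least)
    fix A :: "(real ^ 2) set"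
    assume "A \<in> {A. A \<subseteq> int_lattice \<and> card A = n}"
    then have A: "A \<subseteq> int_lattice" "card A = n" by auto
    then show "ennreal (ratio A) \<le> S_card TYPE(2) n"
      unfolding S_card_def using card[OF A(2)]
      by (auto intro!: Inf_greatest ratio_le_of_stein_ineq simp: admissible)
  qed
  show "M_card TYPE(2) n \<ge> R_pin_card n"
    unfolding R_pin_card_def
  proof (rule SUP_least)
    fix A :: "(real ^ 2) set"
    assume "A \<in> {A. A \<subseteq> int_lattice \<and> card A = n}"
    then have A: "A \<subseteq> int_lattice" "card A = n" by auto
    then show "ennreal (pin_ratio A) \<le> M_card TYPE(2) n"
      unfolding M_card_def using card[OF A(2)]
      by (auto intro!: Inf_greatest pin_ratio_le_of_mt_ineq simp: admissible)
  qed
qed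

end
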